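(* Let $(S,\Phi)$ be a stable coherent system with $n$ multi-state components (stable with respect to the usual ordering $1<2<\cdots<n$ of the components), and let $l$ be a level of $S$. Then the $l$-reliability of $S$ is given by $$R_l(S)=\sum_{i=0}^{d}(-1)^i\sum_{|u|=i}pr\big(\mathrm{md}([m;u])\big),$$ where, for each $i$, the inner sum runs over all admissible symbols $[m;u]$ of $I_{S,l}$ with $|u|=i$, and $d$ is the maximal length of any sequence $u$ such that $[m;u]$ is an admissible symbol.
   Context: System. $S$ has components $c_1,\dots,c_n$, where $c_i$ takes (random) states in $L_i=\{0,\dots,M_i\}$, and structure function $\Phi:L_1\times\cdots\times L_n\to\{0,\dots,M\}$; it is coherent if $\Phi$ is non-decreasing for the componentwise order and every component is relevant (its state does affect the system's level). An $l$-path is a tuple $s\in L_1\times\cdots\times L_n$ with $\Phi(s)\ge l$. The $l$-reliability $R_l(S)$ is the probability that $\Phi(c_1,\dots,c_n)\ge l$. For $\mu\in\mathbb{N}_0^n$, $pr(\mu)=pr\big((c_1\ge\mu_1)\wedge\cdots\wedge(c_n\ge\mu_n)\big)$; in particular $pr(\mu)=0$ if $\mu_k>M_k$ for some $k$. Stability. $S$ is stable (with respect to $1<2<\cdots<n$) if for every level $l$, every $l$-path $m=(m_1,\dots,m_i,0,\dots,0)$ with $m_i>0$ (so $i$ is the last component of $m$ not in total failure), and every $j<i$, the tuple obtained from $m$ by replacing $m_i$ with $m_i-1$ and $m_j$ with $m_j+1$ is also an $l$-path, this being required whenever that tuple lies in $L_1\times\cdots\times L_n$ (i.e. $m_j<M_j$).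 Ideal and admissible symbols. Let $\mathbf{k}$ be a field. $I_{S,l}\subset\mathbf{k}[x_1,\dots,x_n]$ is the monomial ideal generated by the monomials $x_1^{s_1}\cdots x_n^{s_n}$ for $s$ an $l$-path. For a monomial $m$, $\max(m)$ is the largest index of a variable dividing $m$. An admissible symbol of $I_{S,l}$ is a pair $[m;u]$ where $m$ is a monomial in the minimal monomial generating set of $I_{S,l}$ and $u=(u_1<\cdots<u_i)$ is a (possibly empty) increasing sequence of indices in $\{1,\dots,n\}$ with $\max(u)<\max(m)$ (a condition that is vacuous when $u=\emptyset$); $|u|=i$ denotes its length. The multi-degree $\mathrm{md}([m;u])\in\mathbb{N}_0^n$ is the exponent vector of the monomial $m\cdot x_{u_1}\cdots x_{u_i}$. *)

theory Defs
  imports "HOL-Probability.Probability" "HOL-Algebra.Ideal" "HOL-Library.Poly_Mapping"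
begin

text \<open>Components are indexed by 1, ..., n; component i has the states 0, ..., mx i.\<close>

definition states :: "nat \<Rightarrow> (nat \<Rightarrow> nat) \<Rightarrow> (nat \<Rightarrow> nat) set" where
  "states n mx = (\<Pi>\<^sub>E i\<in>{1..n}. {0..mx i})"

definition coherent_system :: "nat \<Rightarrow> (nat \<Rightarrow> nat) \<Rightarrow> nat \<Rightarrow> ((nat \<Rightarrow> nat) \<Rightarrow> nat) \<Rightarrow> bool" where
  "coherent_system n mx M \<Phi> \<longleftrightarrow>
     \<Phi> \<in> states n mx \<rightarrow> {0..M} \<and>
     (\<forall>s\<in>states n mx. \<forall>t\<in>states n mx. (\<forall>i\<in>{1..n}. s i \<le> t i) \<longrightarrow> \<Phi> s \<le> \<Phi> t) \<and>
     (\<forall>i\<in>{1..n}. \<exists>s\<in>states n mx. \<exists>a\<in>{0..mx i}. \<Phi> (s(i := a)) \<noteq> \<Phi> s)"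

definition paths :: "nat \<Rightarrow> (nat \<Rightarrow> nat) \<Rightarrow> ((nat \<Rightarrow> nat) \<Rightarrow> nat) \<Rightarrow> nat \<Rightarrow> (nat \<Rightarrow> nat) set" where
  "paths n mx \<Phi> l = {s \<in> states n mx. l \<le> \<Phi> s}"

definition stable_system :: "nat \<Rightarrow> (nat \<Rightarrow> nat) \<Rightarrow> nat \<Rightarrow> ((nat \<Rightarrow> nat) \<Rightarrow> nat) \<Rightarrow> bool" where
  "stable_system n mx M \<Phi> \<longleftrightarrow>
     (\<forall>l\<in>{0..M}. \<forall>m\<in>paths n mx \<Phi> l. \<forall>i\<in>{1..n}. \<forall>j\<in>{1..<i}.
        0 < m i \<and> (\<forall>k\<in>{i<..n}. m k = 0) \<and> m j < mx j \<longrightarrow>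
        m(i := m i - 1, j := m j + 1) \<in> paths n mx \<Phi> l)"

definition random_states :: "'w measure \<Rightarrow> nat \<Rightarrow> (nat \<Rightarrow> nat) \<Rightarrow> (nat \<Rightarrow> 'w \<Rightarrow> nat) \<Rightarrow> bool" where
  "random_states P n mx c \<longleftrightarrow>
     prob_space P \<and> (\<forall>i\<in>{1..n}. c i \<in> measurable P (count_space {0..mx i}))"

definition reliability ::
    "'w measure \<Rightarrow> nat \<Rightarrow> (nat \<Rightarrow> 'w \<Rightarrow> nat) \<Rightarrow> ((nat \<Rightarrow> nat) \<Rightarrow> nat) \<Rightarrow> nat \<Rightarrow> real" where
  "reliability P n c \<Phi> l = measure P {\<omega> \<in> space P. l \<le> \<Phi> (\<lambda>i\<in>{1..n}. c i \<omega>)}"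

definition pr :: "'w measure \<Rightarrow> nat \<Rightarrow> (nat \<Rightarrow> 'w \<Rightarrow> nat) \<Rightarrow> (nat \<Rightarrow>\<^sub>0 nat) \<Rightarrow> real" where
  "pr P n c \<mu> = measure P {\<omega> \<in> space P. \<forall>i\<in>{1..n}. Poly_Mapping.lookup \<mu> i \<le> c i \<omega>}"

text \<open>
  A monomial is represented by its exponent vector, a finitely supported function on the variable
  indices; multiplication of monomials is addition of exponent vectors. A polynomial maps
  monomials to coefficients, with the ring operations of \<^theory>\<open>HOL-Library.Poly_Mapping\<close>.
\<close>

type_synonym 'k mpoly = "(nat \<Rightarrow>\<^sub>0 nat) \<Rightarrow>\<^sub>0 'k"

definition monomials :: "nat \<Rightarrow> (nat \<Rightarrow>\<^sub>0 nat) set" where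
  "monomials n = {t. Poly_Mapping.keys t \<subseteq> {1..n}}"

definition mpoly_ring :: "nat \<Rightarrow> ('k::field) mpoly ring" where
  "mpoly_ring n = \<lparr>carrier = {p. Poly_Mapping.keys p \<subseteq> monomials n}, mult = (*), one = 1, zero = 0, add = (+)\<rparr>"

lemma mpoly_ring_cring: "cring (mpoly_ring n :: ('k::field) mpoly ring)"
proof -
  have add: "p + q \<in> carrier (mpoly_ring n)"
    if "p \<in> carrier (mpoly_ring n)" "q \<in> carrier (mpoly_ring n)" for p q :: "'k mpoly"
    using that Poly_Mapping.keys_add[of p q] by (auto simp: mpoly_ring_def)
  have mult: "p * q \<in> carrier (mpoly_ring n)"
    if "p \<in> carrier (mpoly_ring n)" "q \<in> carrier (mpoly_ring n)" for p q :: "'k mpoly"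
  proof -
    have "a + b \<in> monomials n" if "a \<in> monomials n" "b \<in> monomials n" for a b
      using that Poly_Mapping.keys_add[of a b] by (auto simp: monomials_def)
    then show ?thesis
      using that keys_mult[of p q] by (fastforce simp: mpoly_ring_def)
  qed
  show ?thesis
  proof (rule cringI)
    show "abelian_group (mpoly_ring n :: 'k mpoly ring)"
    proof (rule abelian_groupI)
      fix p :: "'k mpoly" assume "p \<in> carrier (mpoly_ring n)"
      then show "\<exists>q\<in>carrier (mpoly_ring n). q \<oplus>\<^bsub>mpoly_ring n\<^esub> p = \<zero>\<^bsub>mpoly_ring n\<^esub>"
        by (intro bexI[of _ "- p"]) (auto simp: mpoly_ring_def)
    qed (use add in \<open>auto simp: mpoly_ring_def algebra_simps\<close>)
    show "Group.comm_monoid (mpoly_ring n :: 'k mpoly ring)"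
      by (rule comm_monoidI)
        (use mult in \<open>auto simp: mpoly_ring_def monomials_def algebra_simps\<close>)
  qed (auto simp: mpoly_ring_def algebra_simps)
qed

abbreviation mono_poly :: "(nat \<Rightarrow>\<^sub>0 nat) \<Rightarrow> ('k::field) mpoly" where
  "mono_poly t \<equiv> Poly_Mapping.single t 1"

definition tuple_monomial :: "nat \<Rightarrow> (nat \<Rightarrow> nat) \<Rightarrow> (nat \<Rightarrow>\<^sub>0 nat)" where
  "tuple_monomial n s = (\<Sum>i\<in>{1..n}. Poly_Mapping.single i (s i))"

definition path_ideal ::
    "nat \<Rightarrow> (nat \<Rightarrow> nat) \<Rightarrow> ((nat \<Rightarrow> nat) \<Rightarrow> nat) \<Rightarrow> nat \<Rightarrow> ('k::field) mpoly set" where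
  "path_ideal n mx \<Phi> l =
     genideal (mpoly_ring n) ((\<lambda>s. mono_poly (tuple_monomial n s)) ` paths n mx \<Phi> l)"

text \<open>Every monomial ideal has exactly one minimal generating set of monomials.\<close>

definition min_mon_gens :: "nat \<Rightarrow> ('k::field) mpoly set \<Rightarrow> (nat \<Rightarrow>\<^sub>0 nat) set" where
  "min_mon_gens n I =
     (THE G. G \<subseteq> monomials n \<and> genideal (mpoly_ring n) (mono_poly ` G) = I \<and>
        (\<forall>H. H \<subset> G \<longrightarrow> genideal (mpoly_ring n) (mono_poly ` H) \<noteq> I))"

text \<open>The monomial 1 has largest index 0 by convention; variable indices start at 1.\<close>

definition max_var :: "(nat \<Rightarrow>\<^sub>0 nat) \<Rightarrow> nat" where
  "max_var t = (if Poly_Mapping.keys t = {} then 0 else Max (Poly_Mapping.keys t))"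

definition admissible_symbols ::
    "nat \<Rightarrow> ('k::field) mpoly set \<Rightarrow> ((nat \<Rightarrow>\<^sub>0 nat) \<times> nat list) set" where
  "admissible_symbols n I =
     {(m, u). m \<in> min_mon_gens n I \<and> sorted_wrt (<) u \<and> set u \<subseteq> {1..n} \<and>
              (u \<noteq> [] \<longrightarrow> Max (set u) < max_var m)}"

definition md :: "(nat \<Rightarrow>\<^sub>0 nat) \<times> nat list \<Rightarrow> (nat \<Rightarrow>\<^sub>0 nat)" where
  "md \<sigma> = fst \<sigma> + (\<Sum>j\<leftarrow>snd \<sigma>. Poly_Mapping.single j 1)"

end

theory Submission
  imports Defs
begin

text \<open>
  Fix a state \<open>s\<close>. The symbols \<open>[m;u]\<close> with multi-degree below \<open>s\<close> are those with \<open>m \<le> s\<close> and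
  \<open>u\<close> a subset of \<open>J = {j < max m. m\<^sub>j < s\<^sub>j}\<close>, so their alternating sum is the number of minimal
  generators \<open>m \<le> s\<close> with \<open>J = {}\<close>, that is, with \<open>m\<^sub>j = s\<^sub>j\<close> for all \<open>j < max m\<close>. If \<open>s\<close> is
  not a path, there are none. Otherwise there is exactly one: two such generators are comparable,
  hence equal, and for existence, among the paths below \<open>s\<close> that
  agree with \<open>s\<close> before their last positive entry, take one of least total. If an entry of it could
  be lowered, then by stability so could its last positive one, contradicting the choice.
  Integrating this identity of indicator functions gives the formula.
\<close>

section \<open>Monomial ideals\<close>

definition mdvd :: "(nat \<Rightarrow>\<^sub>0 nat) \<Rightarrow> (nat \<Rightarrow>\<^sub>0 nat) \<Rightarrow> bool" where
  "mdvd a b \<longleftrightarrow> (\<forall>i. Poly_Mapping.lookup a i \<le> Poly_Mapping.lookup b i)"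

text \<open>This will turn out to be the minimal generating set of the ideal generated by A, which
  evaluates the definite description in \<open>min_mon_gens\<close>.\<close>

definition minimal_monomials :: "(nat \<Rightarrow>\<^sub>0 nat) set \<Rightarrow> (nat \<Rightarrow>\<^sub>0 nat) set" where
  "minimal_monomials A = {a \<in> A. \<forall>b\<in>A. mdvd b a \<longrightarrow> b = a}"

lemma mdvd_refl: "mdvd a a"
  by (simp add: mdvd_def)

lemma mdvd_trans: "mdvd a b \<Longrightarrow> mdvd b c \<Longrightarrow> mdvd a c"
  unfolding mdvd_def by (meson le_trans)

lemma mdvd_antisym: "mdvd a b \<Longrightarrow> mdvd b a \<Longrightarrow> a = b"
  unfolding mdvd_def by (meson le_antisym poly_mapping_eqI)

lemma keys_mdvd: "mdvd a b \<Longrightarrow> Poly_Mapping.keys a \<subseteq> Poly_Mapping.keys b"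
  unfolding mdvd_def by (metis in_keys_iff le_zero_eq subsetI)

text \<open>Descent on total degree: a proper divisor has strictly smaller total degree, so passing
  to proper divisors within A must stop, and it stops at a minimal element.\<close>

lemma minimal_monomials_below:
  assumes "a \<in> A"
  shows "\<exists>b\<in>minimal_monomials A. mdvd b a"
  using assms
proof (induction "\<Sum>i\<in>Poly_Mapping.keys a. Poly_Mapping.lookup a i" arbitrary: a rule: less_induct)
  case less
  show ?case
  proof (cases "a \<in> minimal_monomials A")
    case True
    then show ?thesis using mdvd_refl by blast
  next
    case False
    then obtain b where b: "b \<in> A" "mdvd b a" "b \<noteq> a"
      using less.prems by (auto simp: minimal_monomials_def)
    obtain i where i: "Poly_Mapping.lookup b i < Poly_Mapping.lookup a i"
      using b mdvd_antisym by (metis mdvd_def not_le)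
    \<comment> \<open>The support of b lies in that of a, so both degrees can be taken over the keys
      of a and compared termwise.\<close>
    have "(\<Sum>i\<in>Poly_Mapping.keys b. Poly_Mapping.lookup b i) =
        (\<Sum>i\<in>Poly_Mapping.keys a. Poly_Mapping.lookup b i)"
      using keys_mdvd[OF b(2)] by (intro sum.mono_neutral_left) (auto simp: in_keys_iff)
    also have "\<dots> < (\<Sum>i\<in>Poly_Mapping.keys a. Poly_Mapping.lookup a i)"
    proof (rule sum_strict_mono_ex1)
      show "\<exists>i\<in>Poly_Mapping.keys a. Poly_Mapping.lookup b i < Poly_Mapping.lookup a i"
        using i by (intro bexI[of _ i]) (auto simp: in_keys_iff)
    qed (use b(2) in \<open>auto simp: mdvd_def\<close>)
    finally show ?thesis
      using less.hyps b mdvd_trans by meson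
  qed
qed

lemma mono_poly_carrier:
  "A \<subseteq> monomials n \<Longrightarrow> (mono_poly ` A :: ('k::field) mpoly set) \<subseteq> carrier (mpoly_ring n)"
  by (auto simp: mpoly_ring_def)

text \<open>Serves as an upper bound for the ideal generated by A. Every monomial of a product x * p
  is some b + c with c a monomial of p, and a divisor of c in A still divides b + c.\<close>

lemma ideal_keys_multiples:
  fixes A :: "(nat \<Rightarrow>\<^sub>0 nat) set" and n :: nat
  defines "J \<equiv> {p :: ('k::field) mpoly. Poly_Mapping.keys p \<subseteq> {t \<in> monomials n. \<exists>a\<in>A. mdvd a t}}"
  shows "ideal J (mpoly_ring n)"
proof -
  interpret cring "mpoly_ring n :: 'k mpoly ring" by (rule mpoly_ring_cring)
  have mult: "x * p \<in> J" if "p \<in> J" "Poly_Mapping.keys x \<subseteq> monomials n" for p x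
  proof -
    have "t \<in> monomials n \<and> (\<exists>a\<in>A. mdvd a t)" if "t \<in> Poly_Mapping.keys (x * p)" for t
    proof -
      obtain b c where t: "t = b + c" "b \<in> Poly_Mapping.keys x" "c \<in> Poly_Mapping.keys p"
        using \<open>t \<in> Poly_Mapping.keys (x * p)\<close> keys_mult[of x p] by blast
      obtain a where a: "a \<in> A" "mdvd a c" and "b \<in> monomials n" "c \<in> monomials n"
        using t \<open>p \<in> J\<close> \<open>Poly_Mapping.keys x \<subseteq> monomials n\<close> unfolding J_def by blast
      moreover have "mdvd a (b + c)"
        using a by (auto simp: mdvd_def lookup_add intro: trans_le_add2)
      ultimately show ?thesis
        using keys_add[of b c] t by (auto simp: monomials_def)
    qed
    then show ?thesis by (auto simp: J_def)
  qed
  have add: "p + q \<in> J" if "p \<in> J" "q \<in> J" for p q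
    using that keys_add[of p q] unfolding J_def by blast
  \<comment> \<open>Negation is multiplication by the constant -1, so it is covered by
    \<open>mult\<close>.\<close>
  have neg: "- p \<in> J" if "p \<in> J" for p
    using mult[OF that, of "- 1"] by (simp add: monomials_def)
  have a_inv: "\<ominus>\<^bsub>mpoly_ring n\<^esub> p = - p" if "p \<in> J" for p :: "'k mpoly"
    by (rule minus_equality) (use that neg[OF that] in \<open>auto simp: mpoly_ring_def J_def\<close>)
  show ?thesis
  proof (rule idealI)
    show "subgroup J (add_monoid (mpoly_ring n))"
    proof (rule group.subgroupI[OF a_group])
      fix p assume "p \<in> J"
      then show "inv\<^bsub>add_monoid (mpoly_ring n)\<^esub> p \<in> J"
        using a_inv[of p] neg[of p] by (simp add: a_inv_def)
    next
      have "0 \<in> J" by (simp add: J_def)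
      then show "J \<noteq> {}" by blast
    qed (use add in \<open>auto simp: mpoly_ring_def J_def\<close>)
  next
    fix p x assume *: "p \<in> J" "x \<in> carrier (mpoly_ring n :: 'k mpoly ring)"
    then show "x \<otimes>\<^bsub>mpoly_ring n\<^esub> p \<in> J"
      using mult by (auto simp: mpoly_ring_def)
    then show "p \<otimes>\<^bsub>mpoly_ring n\<^esub> x \<in> J"
      by (simp add: mpoly_ring_def mult.commute)
  qed (rule ring_axioms)
qed

text \<open>One direction bounds the generated ideal by that of \<open>ideal_keys_multiples\<close>;
  the other multiplies the generator a by the monomial t - a.\<close>

lemma mono_poly_in_genideal_iff:
  assumes A: "A \<subseteq> monomials n" and t: "t \<in> monomials n"
  shows "(mono_poly t :: ('k::field) mpoly) \<in> genideal (mpoly_ring n) (mono_poly ` A) \<longleftrightarrow>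
    (\<exists>a\<in>A. mdvd a t)"
proof -
  interpret cring "mpoly_ring n :: 'k mpoly ring" by (rule mpoly_ring_cring)
  show ?thesis
  proof
    assume "mono_poly t \<in> genideal (mpoly_ring n) (mono_poly ` A :: 'k mpoly set)"
    moreover have "genideal (mpoly_ring n) (mono_poly ` A :: 'k mpoly set) \<subseteq>
        {p. Poly_Mapping.keys p \<subseteq> {t \<in> monomials n. \<exists>a\<in>A. mdvd a t}}"
    proof (rule genideal_minimal[OF ideal_keys_multiples])
      have "a \<in> monomials n \<and> (\<exists>b\<in>A. mdvd b a)" if "a \<in> A" for a
        using that A mdvd_refl[of a] by blast
      then show "(mono_poly ` A :: 'k mpoly set) \<subseteq>
          {p. Poly_Mapping.keys p \<subseteq> {t \<in> monomials n. \<exists>a\<in>A. mdvd a t}}"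
        by (intro image_subsetI CollectI) (simp only: keys_single, auto)
    qed
    ultimately show "\<exists>a\<in>A. mdvd a t"
      by auto
  next
    assume "\<exists>a\<in>A. mdvd a t"
    then obtain a where a: "a \<in> A" "mdvd a t" by blast
    have "(mono_poly a :: 'k mpoly) \<in> genideal (mpoly_ring n) (mono_poly ` A)"
      using a genideal_self[OF mono_poly_carrier[OF A]] by blast
    moreover have "(mono_poly (t - a) :: 'k mpoly) \<in> carrier (mpoly_ring n)"
      using t by (auto simp: mpoly_ring_def monomials_def in_keys_iff lookup_minus)
    ultimately have "mono_poly (t - a) \<otimes>\<^bsub>mpoly_ring n\<^esub> (mono_poly a :: 'k mpoly) \<in>
        genideal (mpoly_ring n) (mono_poly ` A)"
      using ideal.I_l_closed[OF genideal_ideal[OF mono_poly_carrier[OF A]]] by blast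
    \<comment> \<open>Subtraction of exponents is truncated; it is exact here because a divides
      t.\<close>
    moreover have "t - a + a = t"
      using a by (intro poly_mapping_eqI) (simp add: lookup_add lookup_minus mdvd_def)
    ultimately show "(mono_poly t :: 'k mpoly) \<in> genideal (mpoly_ring n) (mono_poly ` A)"
      by (simp add: mpoly_ring_def mult_single)
  qed
qed

lemma genideal_mono_poly_subset_iff:
  assumes A: "A \<subseteq> monomials n" and B: "B \<subseteq> monomials n"
  shows "genideal (mpoly_ring n) (mono_poly ` A :: ('k::field) mpoly set) \<subseteq>
    genideal (mpoly_ring n) (mono_poly ` B) \<longleftrightarrow> (\<forall>a\<in>A. \<exists>b\<in>B. mdvd b a)"
proof -
  interpret cring "mpoly_ring n :: 'k mpoly ring" by (rule mpoly_ring_cring)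
  have "genideal (mpoly_ring n) (mono_poly ` A :: 'k mpoly set) \<subseteq>
      genideal (mpoly_ring n) (mono_poly ` B) \<longleftrightarrow>
      (mono_poly ` A :: 'k mpoly set) \<subseteq> genideal (mpoly_ring n) (mono_poly ` B)"
    by (intro Idl_subset_ideal genideal_ideal mono_poly_carrier A B)
  also have "\<dots> \<longleftrightarrow> (\<forall>a\<in>A. \<exists>b\<in>B. mdvd b a)"
    using mono_poly_in_genideal_iff[OF B, where ?'k = 'k] A by blast
  finally show ?thesis .
qed

text \<open>The minimal elements generate by \<open>minimal_monomials_below\<close>. They are
  irredundant, since the only element of A dividing a minimal b is b itself. Any other generating
  set of monomials contains them, so if it is irredundant as well it equals them.\<close>

lemma min_mon_gens_genideal:
  assumes A: "A \<subseteq> monomials n"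
  shows "min_mon_gens n (genideal (mpoly_ring n) (mono_poly ` A :: ('k::field) mpoly set)) =
    minimal_monomials A"
proof -
  let ?Idl = "\<lambda>G. genideal (mpoly_ring n) (mono_poly ` G :: 'k mpoly set)"
  let ?B = "minimal_monomials A"
  have BA: "?B \<subseteq> A" by (auto simp: minimal_monomials_def)
  have B: "?B \<subseteq> monomials n" using BA A by blast
  have eq: "?Idl ?B = ?Idl A"
    unfolding set_eq_subset genideal_mono_poly_subset_iff[OF A B] genideal_mono_poly_subset_iff[OF B A]
    using minimal_monomials_below BA by (meson mdvd_refl subsetD)
  have min: "?Idl H \<noteq> ?Idl A" if H: "H \<subset> ?B" for H
  proof
    assume "?Idl H = ?Idl A"
    obtain b where b: "b \<in> ?B" "b \<notin> H" using H by blast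
    have "\<exists>h\<in>H. mdvd h b"
      using genideal_mono_poly_subset_iff[of A n H, where ?'k = 'k] A B H \<open>?Idl H = ?Idl A\<close> b BA
      by blast
    then show False
      using b H by (auto simp: minimal_monomials_def)
  qed
  show ?thesis
    unfolding min_mon_gens_def
  proof (rule the_equality)
    fix G assume G: "G \<subseteq> monomials n \<and> ?Idl G = ?Idl A \<and> (\<forall>H. H \<subset> G \<longrightarrow> ?Idl H \<noteq> ?Idl A)"
    have GA: "\<forall>g\<in>G. \<exists>a\<in>A. mdvd a g" and AG: "\<forall>a\<in>A. \<exists>g\<in>G. mdvd g a"
      using genideal_mono_poly_subset_iff[of G n A, where ?'k = 'k]
        genideal_mono_poly_subset_iff[of A n G, where ?'k = 'k] G A by auto
    have "?B \<subseteq> G"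
    proof
      fix b assume b: "b \<in> ?B"
      then obtain g where g: "g \<in> G" "mdvd g b" using AG BA by blast
      then obtain a where "a \<in> A" "mdvd a g" using GA by blast
      \<comment> \<open>The chain a | g | b with a in A collapses, because minimality of b gives a =
        b.\<close>
      then have "g = b"
        using b g mdvd_trans mdvd_antisym by (auto simp: minimal_monomials_def)
      then show "b \<in> G" using g by simp
    qed
    then show "G = ?B" using G eq by blast
  qed (use B eq min in auto)
qed

section \<open>Minimal paths of a stable system\<close>

lemma lookup_tuple_monomial:
  "Poly_Mapping.lookup (tuple_monomial n s) i = (if i \<in> {1..n} then s i else 0)"
proof -
  have "Poly_Mapping.lookup (tuple_monomial n s) i = (\<Sum>j\<in>{1..n}. if j = i then s j else 0)"
    unfolding tuple_monomial_def lookup_sum by (rule sum.cong) (auto simp: lookup_single when_def)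
  then show ?thesis by (simp add: sum.delta)
qed

lemma tuple_monomial_in_monomials: "tuple_monomial n s \<in> monomials n"
  by (auto simp: monomials_def in_keys_iff lookup_tuple_monomial split: if_splits)

lemma mdvd_tuple_monomial:
  "mdvd (tuple_monomial n r) (tuple_monomial n t) \<longleftrightarrow> (\<forall>i\<in>{1..n}. r i \<le> t i)"
  by (auto simp: mdvd_def lookup_tuple_monomial)

text \<open>The convention \<open>max_var\<close> = 0 for the monomial 1 makes this hold without
  exception.\<close>

lemma less_max_var_iff: "j < max_var t \<longleftrightarrow> (\<exists>k>j. Poly_Mapping.lookup t k \<noteq> 0)"
proof (cases "Poly_Mapping.keys t = {}")
  case True
  then show ?thesis by (auto simp: max_var_def in_keys_iff)
next
  case False
  then show ?thesis
    by (auto simp: max_var_def Max_gr_iff in_keys_iff simp del: keys_eq_empty)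
qed

lemma max_var_le: "t \<in> monomials n \<Longrightarrow> max_var t \<le> n"
  unfolding max_var_def monomials_def by auto

lemma states_update:
  assumes "s \<in> states n mx" "i \<in> {1..n}" "a \<le> mx i"
  shows "s(i := a) \<in> states n mx"
  using assms unfolding states_def by (auto simp: PiE_def Pi_def extensional_def)

lemma finite_states: "finite (states n mx)"
  unfolding states_def by (intro finite_PiE) auto

lemma paths_mono:
  assumes "coherent_system n mx M \<Phi>" "r \<in> paths n mx \<Phi> l" "t \<in> states n mx"
    and "\<forall>i\<in>{1..n}. r i \<le> t i"
  shows "t \<in> paths n mx \<Phi> l"
  using assms unfolding coherent_system_def paths_def
  by (metis (mono_tags, lifting) le_trans mem_Collect_eq)

text \<open>Lowering entry k by one leaves a tuple still above the path r, hence a path. If k is not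
  the last positive index i, stability moves one unit from i back to k, and the net effect is to
  lower entry i only.\<close>

lemma stable_lower_last:
  assumes coh: "coherent_system n mx M \<Phi>" and st: "stable_system n mx M \<Phi>" and l: "l \<in> {0..M}"
    and r: "r \<in> paths n mx \<Phi> l" and t: "t \<in> paths n mx \<Phi> l"
    and le: "\<forall>i\<in>{1..n}. r i \<le> t i" and ne: "k \<in> {1..n}" "r k < t k"
    and i: "i \<in> {1..n}" "0 < t i" "\<forall>k\<in>{i<..n}. t k = 0"
  shows "t(i := t i - 1) \<in> paths n mx \<Phi> l"
proof -
  have ts: "t \<in> states n mx" using t by (simp add: paths_def)
  then have tk: "t k \<le> mx k" using ne by (auto simp: states_def)
  let ?t = "t(k := t k - 1)"
  have t': "?t \<in> paths n mx \<Phi> l"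
    using le ne tk by (intro paths_mono[OF coh r] states_update ts) auto
  show ?thesis
  proof (cases "k = i")
    case True
    then show ?thesis using t' by simp
  next
    case False
    with i ne have ki: "k < i"
      by (metis greaterThanAtMost_iff atLeastAtMost_iff linorder_neqE_nat not_less_zero)
    \<comment> \<open>Entry k was just lowered, so it is strictly below its maximum even if
      \<open>t k\<close> = \<open>mx k\<close>; this is the room stability asks for.\<close>
    have "0 < ?t i" "\<forall>k\<in>{i<..n}. ?t k = 0" "?t k < mx k" "k \<in> {1..<i}"
      using ki i ne tk by auto
    then have "?t(i := ?t i - 1, k := ?t k + 1) \<in> paths n mx \<Phi> l"
      using st l t' i(1) unfolding stable_system_def by blast
    moreover have "?t(i := ?t i - 1, k := ?t k + 1) = t(i := t i - 1)"
      using ki ne by (auto simp: fun_eq_iff)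
    ultimately show ?thesis by simp
  qed
qed

lemma stable_minimal_path_exists:
  assumes coh: "coherent_system n mx M \<Phi>" and st: "stable_system n mx M \<Phi>" and l: "l \<in> {0..M}"
    and s: "s \<in> paths n mx \<Phi> l"
  obtains t where "t \<in> paths n mx \<Phi> l" "\<forall>i\<in>{1..n}. t i \<le> s i"
    "\<forall>j\<in>{1..n}. \<forall>k\<in>{j<..n}. 0 < t k \<longrightarrow> t j = s j"
    "\<forall>r\<in>paths n mx \<Phi> l. (\<forall>i\<in>{1..n}. r i \<le> t i) \<longrightarrow> (\<forall>i\<in>{1..n}. r i = t i)"
proof -
  \<comment> \<open>T contains s itself, so an element of least total exists.\<close>
  define T where "T = {t \<in> paths n mx \<Phi> l. (\<forall>i\<in>{1..n}. t i \<le> s i) \<and>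
    (\<forall>j\<in>{1..n}. \<forall>k\<in>{j<..n}. 0 < t k \<longrightarrow> t j = s j)}"
  have "s \<in> T" using s by (simp add: T_def)
  define t where "t = arg_min (\<lambda>t. \<Sum>i\<in>{1..n}. t i) (\<lambda>t. t \<in> T)"
  have tT: "t \<in> T" and least: "\<forall>t'\<in>T. (\<Sum>i\<in>{1..n}. t i) \<le> (\<Sum>i\<in>{1..n}. t' i)"
    using arg_min_nat_lemma[of "\<lambda>t. t \<in> T", OF \<open>s \<in> T\<close>, of "\<lambda>t. \<Sum>i\<in>{1..n}. t i"]
    by (simp_all add: t_def)
  have "\<forall>i\<in>{1..n}. r i = t i"
    if r: "r \<in> paths n mx \<Phi> l" and le: "\<forall>i\<in>{1..n}. r i \<le> t i" for r
  proof (rule ccontr)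
    assume "\<not> (\<forall>i\<in>{1..n}. r i = t i)"
    then obtain k where k: "k \<in> {1..n}" "r k < t k" using le by (meson le_neq_implies_less)
    define i where "i = Max {i \<in> {1..n}. 0 < t i}"
    have "i \<in> {i \<in> {1..n}. 0 < t i}"
      unfolding i_def by (rule Max_in) (use k in auto)
    moreover have i_max: "k' \<le> i" if "k' \<in> {1..n}" "0 < t k'" for k'
      unfolding i_def by (rule Max_ge) (use that in auto)
    moreover have "t k' = 0" if "k' \<in> {i<..n}" for k'
      using i_max[of k'] that by (cases "t k' = 0") auto
    ultimately have i: "i \<in> {1..n}" "0 < t i" "\<forall>k\<in>{i<..n}. t k = 0"
      by blast+
    let ?t = "t(i := t i - 1)"
    have "?t \<in> paths n mx \<Phi> l"
      using stable_lower_last[OF coh st l r _ le k i] tT by (simp add: T_def)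
    moreover have "\<forall>i\<in>{1..n}. ?t i \<le> s i"
      using tT by (auto simp: T_def intro: le_trans[OF diff_le_self])
    \<comment> \<open>Lowering the last positive entry keeps the agreement with s: a positive entry
      of \<open>?t\<close> sits at an index k' <= i, and any j < k' is then below i, where nothing
      changed.\<close>
    moreover have "?t j = s j" if "j \<in> {1..n}" "k' \<in> {j<..n}" "0 < ?t k'" for j k'
    proof -
      have "0 < t k'" using that i by (auto split: if_splits)
      moreover from this have "k' \<le> i" using i_max[of k'] that by simp
      ultimately have "t j = s j" "j < i" using that tT unfolding T_def by (blast, simp)
      then show ?thesis by simp
    qed
    ultimately have "?t \<in> T" unfolding T_def by blast
    moreover have "(\<Sum>j\<in>{1..n}. ?t j) < (\<Sum>j\<in>{1..n}. t j)"
      by (rule sum_strict_mono_ex1) (use i in auto)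
    ultimately show False using least by (meson not_le)
  qed
  then show ?thesis using that[of t] tT unfolding T_def by blast
qed

text \<open>Two monomials dividing s that agree with s before their last variable are comparable
  under divisibility, and comparable minimal elements coincide.\<close>

lemma minimal_generators_unique:
  assumes m: "m \<in> minimal_monomials A" and m': "m' \<in> minimal_monomials A"
    and "mdvd m s" "\<forall>j<max_var m. Poly_Mapping.lookup m j = Poly_Mapping.lookup s j"
    and "mdvd m' s" "\<forall>j<max_var m'. Poly_Mapping.lookup m' j = Poly_Mapping.lookup s j"
  shows "m = m'"
proof -
  have zero: "Poly_Mapping.lookup t k = 0" if "max_var t < k" for t k
    using less_max_var_iff[of "max_var t" t] that by auto
  have le: "mdvd a b \<or> mdvd b a"
    if "mdvd a s" "mdvd b s" "max_var a \<le> max_var b"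
      and "\<forall>j<max_var a. Poly_Mapping.lookup a j = Poly_Mapping.lookup s j"
      and "\<forall>j<max_var b. Poly_Mapping.lookup b j = Poly_Mapping.lookup s j" for a b
  proof -
    \<comment> \<open>Before the last variable of b, b equals s and so dominates a; after it, a
      vanishes. Only the exponent at \<open>max_var b\<close> is left to compare.\<close>
    have off: "Poly_Mapping.lookup a k \<le> Poly_Mapping.lookup b k" if "k \<noteq> max_var b" for k
    proof (cases "k < max_var b")
      case True
      then show ?thesis using \<open>mdvd a s\<close> that \<open>\<forall>j<max_var b. _\<close> by (simp add: mdvd_def)
    next
      case False
      then show ?thesis using that \<open>max_var a \<le> max_var b\<close> zero[of a k] by simp
    qed
    show ?thesis
    proof (cases "Poly_Mapping.lookup a (max_var b) \<le> Poly_Mapping.lookup b (max_var b)")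
      case True
      then show ?thesis using off unfolding mdvd_def by metis
    next
      case False
      \<comment> \<open>An excess of a at this index means the variable occurs in a. Both monomials
        then equal s before the common last variable, so b divides a.\<close>
      then have "max_var a = max_var b" using zero[of a "max_var b"] that(3) by fastforce
      have "Poly_Mapping.lookup b k \<le> Poly_Mapping.lookup a k" for k
        using \<open>max_var a = max_var b\<close> False that(4,5) zero[of b k]
        by (cases k "max_var b" rule: linorder_cases) auto
      then show ?thesis by (simp add: mdvd_def)
    qed
  qed
  have "mdvd m m' \<or> mdvd m' m"
    using le[OF assms(3,5) _ assms(4,6)] le[OF assms(5,3) _ assms(6,4)]
    by (cases "max_var m \<le> max_var m'") auto
  then show ?thesis using m m' by (auto simp: minimal_monomials_def)
qed

text \<open>C collects the generators whose alternating sum at s does not cancel; its cardinality is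
  the value of the whole sum over symbols at s.\<close>

lemma stable_minimal_generator_ex1:
  assumes coh: "coherent_system n mx M \<Phi>" and st: "stable_system n mx M \<Phi>" and l: "l \<in> {0..M}"
    and s: "s \<in> states n mx"
  defines "B \<equiv> minimal_monomials (tuple_monomial n ` paths n mx \<Phi> l)"
  defines "C \<equiv> {m \<in> B. mdvd m (tuple_monomial n s) \<and>
      (\<forall>j\<in>{1..<max_var m}. Poly_Mapping.lookup m j = s j)}"
  shows "card C = of_bool (s \<in> paths n mx \<Phi> l)"
proof -
  \<comment> \<open>Two harmless changes of range: index 0 is no variable, so both exponents vanish
    there, and below \<open>max_var m\<close> <= n the exponents of
    \<open>tuple_monomial n s\<close> are the entries of s.\<close>
  have agree: "\<forall>j<max_var m. Poly_Mapping.lookup m j = Poly_Mapping.lookup (tuple_monomial n s) j"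
    if "m \<in> C" for m
  proof -
    obtain t where "m = tuple_monomial n t"
      using \<open>m \<in> C\<close> unfolding C_def B_def minimal_monomials_def by blast
    then show ?thesis
      using that max_var_le[OF tuple_monomial_in_monomials, of n t]
      by (auto simp: C_def lookup_tuple_monomial)
  qed
  have uniq: "m = m'" if "m \<in> C" "m' \<in> C" for m m'
    using minimal_generators_unique[of m _ m' "tuple_monomial n s"] agree that
    unfolding C_def B_def by blast
  show ?thesis
  proof (cases "s \<in> paths n mx \<Phi> l")
    case True
    obtain t where t: "t \<in> paths n mx \<Phi> l" "\<forall>i\<in>{1..n}. t i \<le> s i"
        "\<forall>j\<in>{1..n}. \<forall>k\<in>{j<..n}. 0 < t k \<longrightarrow> t j = s j"
        "\<forall>r\<in>paths n mx \<Phi> l. (\<forall>i\<in>{1..n}. r i \<le> t i) \<longrightarrow> (\<forall>i\<in>{1..n}. r i = t i)"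
      by (rule stable_minimal_path_exists[OF coh st l True])
    have "tuple_monomial n t \<in> C"
    proof -
      have "tuple_monomial n r = tuple_monomial n t"
        if "r \<in> paths n mx \<Phi> l" "mdvd (tuple_monomial n r) (tuple_monomial n t)" for r
        using t(4) that by (intro poly_mapping_eqI) (simp add: mdvd_tuple_monomial lookup_tuple_monomial)
      then have "tuple_monomial n t \<in> B"
        using t(1) unfolding B_def minimal_monomials_def by blast
      moreover have "Poly_Mapping.lookup (tuple_monomial n t) j = s j"
        if "j \<in> {1..<max_var (tuple_monomial n t)}" for j
      proof -
        have "\<exists>k\<in>{j<..n}. 0 < t k"
          using that less_max_var_iff[of j "tuple_monomial n t"]
          by (auto simp: lookup_tuple_monomial split: if_splits)
        then show ?thesis using t(3) that by (force simp: lookup_tuple_monomial)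
      qed
      ultimately show ?thesis using t(2) by (simp add: C_def mdvd_tuple_monomial)
    qed
    then have "C = {tuple_monomial n t}" using uniq by blast
    then show ?thesis using True by simp
  next
    case False
    \<comment> \<open>A generator dividing the monomial of s comes from a path below s, and
      monotonicity would make s a path.\<close>
    have "m \<notin> C" for m
    proof
      assume "m \<in> C"
      then obtain t where "t \<in> paths n mx \<Phi> l" "mdvd (tuple_monomial n t) (tuple_monomial n s)"
        by (auto simp: C_def B_def minimal_monomials_def)
      then show False
        using paths_mono[OF coh _ s] False by (simp add: mdvd_tuple_monomial)
    qed
    then have "C = {}" by blast
    then show ?thesis using False by simp
  qed
qed

section \<open>Alternating sums over admissible symbols\<close>

text \<open>Expand the product of the factors (-1) + 1 over A; the empty product is 1.\<close>

lemma sum_Pow_alternating: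
  assumes "finite A"
  shows "(\<Sum>X\<in>Pow A. (-1) ^ card X) = (of_bool (A = {}) :: 'a::comm_ring_1)"
proof -
  have "(\<Sum>X\<in>Pow A. (-1) ^ card X) = (\<Prod>i\<in>A. (-1) + (1::'a))"
    using prod_add[OF assms, of "\<lambda>_. -1" "\<lambda>_. 1 :: 'a"] by simp
  then show ?thesis using assms by (auto simp: power_0_left)
qed

text \<open>A finite set has exactly one increasing enumeration, so sums over sequences u become
  sums over subsets.\<close>

lemma bij_betw_set_strict_sorted:
  assumes "finite (A :: 'a::linorder set)"
  shows "bij_betw set {u. sorted_wrt (<) u \<and> set u \<subseteq> A} (Pow A)"
proof (rule bij_betw_imageI)
  show "inj_on set {u. sorted_wrt (<) u \<and> set u \<subseteq> A}"
    by (auto intro!: inj_onI strict_sorted_equal)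
  have "X \<in> set ` {u. sorted_wrt (<) u \<and> set u \<subseteq> A}" if "X \<subseteq> A" for X
    using finite_subset[OF that assms] that
    by (intro image_eqI[of _ _ "sorted_list_of_set X"]) auto
  then show "set ` {u. sorted_wrt (<) u \<and> set u \<subseteq> A} = Pow A" by blast
qed

lemma lookup_md:
  assumes "distinct u"
  shows "Poly_Mapping.lookup (md (m, u)) i = Poly_Mapping.lookup m i + of_bool (i \<in> set u)"
proof -
  have "Poly_Mapping.lookup (\<Sum>j\<leftarrow>u. Poly_Mapping.single j (1::nat)) i = of_bool (i \<in> set u)"
    using assms by (induction u) (auto simp: lookup_add lookup_single when_def)
  then show ?thesis by (simp add: md_def lookup_add)
qed

definition symbol_indices :: "(nat \<Rightarrow>\<^sub>0 nat) \<Rightarrow> nat list set" where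
  "symbol_indices m = {u. sorted_wrt (<) u \<and> set u \<subseteq> {1..<max_var m}}"

lemma finite_symbol_indices: "finite (symbol_indices m)"
  using bij_betw_finite[OF bij_betw_set_strict_sorted[of "{1..<max_var m}"]]
  by (simp add: symbol_indices_def)

text \<open>Since \<open>max_var m\<close> <= n, the condition max(u) < max(m) together with
  positive indices already places u in {1..n}. The range of u thus depends on m alone.\<close>

lemma admissible_symbols_eq:
  fixes I :: "('k::field) mpoly set"
  assumes "min_mon_gens n I \<subseteq> monomials n"
  shows "admissible_symbols n I = (SIGMA m : min_mon_gens n I. symbol_indices m)"
proof -
  have "sorted_wrt (<) u \<and> set u \<subseteq> {1..n} \<and> (u \<noteq> [] \<longrightarrow> Max (set u) < max_var m) \<longleftrightarrow>
      u \<in> symbol_indices m" if "m \<in> min_mon_gens n I" for m u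
    using max_var_le[of m n] assms that by (cases "u = []") (force simp: symbol_indices_def)+
  then show ?thesis unfolding admissible_symbols_def by blast
qed

lemma sum_symbol_indices:
  assumes m: "m \<in> monomials n"
  shows "(\<Sum>u\<in>symbol_indices m. (-1) ^ length u *
      of_bool (\<forall>i\<in>{1..n}. Poly_Mapping.lookup (md (m, u)) i \<le> s i)) =
    (of_bool (mdvd m (tuple_monomial n s) \<and>
      (\<forall>j\<in>{1..<max_var m}. Poly_Mapping.lookup m j = s j)) :: real)"
proof -
  let ?m = "Poly_Mapping.lookup m"
  let ?U = "{1..<max_var m}"
  \<comment> \<open>The indices at which one more factor still fits below s. As u has no
    repetitions, it raises each exponent by at most one.\<close>
  define J where "J = {j \<in> ?U. ?m j < s j}"
  have dvd: "mdvd m (tuple_monomial n s) \<longleftrightarrow> (\<forall>i\<in>{1..n}. ?m i \<le> s i)"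
    using m by (auto simp: mdvd_def lookup_tuple_monomial monomials_def in_keys_iff)
  have U: "?U \<subseteq> {1..n}" using max_var_le[OF m] by auto
  have "(\<Sum>u\<in>symbol_indices m. (-1) ^ length u *
        of_bool (\<forall>i\<in>{1..n}. Poly_Mapping.lookup (md (m, u)) i \<le> s i)) =
      (\<Sum>u\<in>symbol_indices m. (-1) ^ card (set u) *
        (of_bool (mdvd m (tuple_monomial n s) \<and> set u \<subseteq> J) :: real))"
  proof (rule sum.cong)
    fix u assume u: "u \<in> symbol_indices m"
    then have dist: "distinct u" and sub: "set u \<subseteq> ?U"
      by (auto simp: symbol_indices_def strict_sorted_iff)
    have "(\<forall>i\<in>{1..n}. Poly_Mapping.lookup (md (m, u)) i \<le> s i) \<longleftrightarrow>
        mdvd m (tuple_monomial n s) \<and> set u \<subseteq> J"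
    proof -
      have "?m i + of_bool (i \<in> set u) \<le> s i \<longleftrightarrow> ?m i \<le> s i \<and> (i \<in> set u \<longrightarrow> ?m i < s i)" for i
        by auto
      then show ?thesis
        unfolding lookup_md[OF dist] dvd J_def using sub U by blast
    qed
    then show "(-1) ^ length u * of_bool (\<forall>i\<in>{1..n}. Poly_Mapping.lookup (md (m, u)) i \<le> s i) =
        (-1) ^ card (set u) * (of_bool (mdvd m (tuple_monomial n s) \<and> set u \<subseteq> J) :: real)"
      using distinct_card[OF dist] by simp
  qed simp
  also have "\<dots> = (\<Sum>X\<in>Pow ?U. (-1) ^ card X * of_bool (mdvd m (tuple_monomial n s) \<and> X \<subseteq> J))"
    unfolding symbol_indices_def
    by (rule sum.reindex_bij_betw[OF bij_betw_set_strict_sorted]) simp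
  also have "\<dots> = (\<Sum>X\<in>Pow J. (-1) ^ card X * of_bool (mdvd m (tuple_monomial n s)))"
    by (rule sum.mono_neutral_cong_right) (auto simp: J_def)
  also have "\<dots> = of_bool (J = {}) * of_bool (mdvd m (tuple_monomial n s))"
    by (simp add: sum_Pow_alternating J_def flip: sum_distrib_right)
  also have "\<dots> = of_bool (mdvd m (tuple_monomial n s) \<and> (\<forall>j\<in>?U. ?m j = s j))"
  proof -
    \<comment> \<open>Divisibility gives <= at every index, so the absence of strict inequality is
      equality.\<close>
    have "J = {} \<longleftrightarrow> (\<forall>j\<in>?U. ?m j = s j)" if "mdvd m (tuple_monomial n s)"
    proof -
      have "\<forall>j\<in>?U. ?m j \<le> s j" using that U unfolding dvd by blast
      then show ?thesis unfolding J_def by (auto simp: le_less)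
    qed
    then show ?thesis by auto
  qed
  finally show ?thesis .
qed

section \<open>The random state vector\<close>

text \<open>The state space is finite, so preimages of single states suffice, and each is a finite
  intersection of events \<open>c i \<omega> = s i\<close>.\<close>

lemma random_states_measurable:
  assumes "random_states P n mx c"
  shows "(\<lambda>\<omega>. \<lambda>i\<in>{1..n}. c i \<omega>) \<in> measurable P (count_space (states n mx))"
proof -
  have c: "c i \<in> measurable P (count_space {0..mx i})" if "i \<in> {1..n}" for i
    using assms that by (simp add: random_states_def)
  have "(\<lambda>\<omega>. \<lambda>i\<in>{1..n}. c i \<omega>) -` {s} \<inter> space P \<in> sets P" if "s \<in> states n mx" for s
  proof -
    have "(\<lambda>\<omega>. \<lambda>i\<in>{1..n}. c i \<omega>) -` {s} \<inter> space P = {\<omega> \<in> space P. \<forall>i\<in>{1..n}. c i \<omega> = s i}"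
      using that by (auto simp: states_def PiE_def extensional_def fun_eq_iff)
    also have "\<dots> \<in> sets P"
    proof (rule sets.sets_Collect_finite_All)
      fix i assume i: "i \<in> {1..n}"
      have "c i -` {s i} \<inter> space P \<in> sets P"
        using that i by (intro measurable_sets[OF c[OF i]]) (auto simp: states_def)
      moreover have "c i -` {s i} \<inter> space P = {\<omega> \<in> space P. c i \<omega> = s i}" by auto
      ultimately show "{\<omega> \<in> space P. c i \<omega> = s i} \<in> sets P" by simp
    qed simp
    finally show ?thesis .
  qed
  moreover have "(\<lambda>\<omega>. \<lambda>i\<in>{1..n}. c i \<omega>) \<in> space P \<rightarrow> states n mx"
    using measurable_space[OF c] by (fastforce simp: states_def)
  ultimately show ?thesis
    by (simp add: measurable_count_space_eq2[OF finite_states])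
qed

text \<open>Decomposes an event by the value of the state vector, so that integrating indicator
  functions becomes a finite sum weighted by point masses.\<close>

lemma measure_random_state:
  assumes "random_states P n mx c"
  defines "X \<equiv> \<lambda>\<omega>. \<lambda>i\<in>{1..n}. c i \<omega>"
  shows "measure P {\<omega> \<in> space P. Q (X \<omega>)} =
    (\<Sum>s\<in>states n mx. measure P (X -` {s} \<inter> space P) * of_bool (Q s))"
proof -
  interpret prob_space P using assms by (simp add: random_states_def)
  have X: "X \<in> measurable P (count_space (states n mx))"
    unfolding X_def by (rule random_states_measurable[OF assms(1)])
  let ?A = "{s \<in> states n mx. Q s}"
  have "{\<omega> \<in> space P. Q (X \<omega>)} = (\<Union>s\<in>?A. X -` {s} \<inter> space P)"
    using measurable_space[OF X] by auto
  also have "measure P \<dots> = (\<Sum>s\<in>?A. measure P (X -` {s} \<inter> space P))"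
    using finite_states measurable_sets[OF X]
    by (intro finite_measure_finite_Union) (auto simp: disjoint_family_on_def)
  also have "\<dots> = (\<Sum>s\<in>states n mx. measure P (X -` {s} \<inter> space P) * of_bool (Q s))"
    using finite_states by (intro sum.mono_neutral_cong_left) auto
  finally show ?thesis .
qed

section \<open>Integration of the pointwise identity and grouping by length\<close>

theorem proposition5p6:
  fixes P :: "'w measure" and c :: "nat \<Rightarrow> 'w \<Rightarrow> nat"
    and n M l d :: nat and mx :: "nat \<Rightarrow> nat" and \<Phi> :: "(nat \<Rightarrow> nat) \<Rightarrow> nat"
    and I :: "('k::field) mpoly set"
  assumes "random_states P n mx c"
    and "coherent_system n mx M \<Phi>"
    and "stable_system n mx M \<Phi>"
    and "l \<in> {0..M}"
    and "I = path_ideal n mx \<Phi> l"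
    and "d = Max {length u | m u. (m, u) \<in> admissible_symbols n I}"
  shows "reliability P n c \<Phi> l =
    (\<Sum>i=0..d. (-1) ^ i * (\<Sum>\<sigma> | \<sigma> \<in> admissible_symbols n I \<and> length (snd \<sigma>) = i. pr P n c (md \<sigma>)))"
proof -
  note rs = assms(1) and coh = assms(2)
  define A where "A = tuple_monomial n ` paths n mx \<Phi> l"
  define B where "B = minimal_monomials A"
  define S where "S = admissible_symbols n I"
  have finB: "finite B"
    using finite_states[of n mx] unfolding B_def A_def minimal_monomials_def paths_def by simp
  have B: "B \<subseteq> monomials n"
    using tuple_monomial_in_monomials unfolding B_def A_def minimal_monomials_def by blast
  have A: "A \<subseteq> monomials n"
    using tuple_monomial_in_monomials unfolding A_def by blast
  have "I = genideal (mpoly_ring n) (mono_poly ` A)"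
    unfolding assms(5) path_ideal_def A_def image_image ..
  then have gens: "min_mon_gens n I = B"
    using min_mon_gens_genideal[OF A] by (simp add: B_def)
  have S: "S = (SIGMA m : B. symbol_indices m)"
    using admissible_symbols_eq[of n I] B unfolding gens S_def by simp
  have finS: "finite S"
    unfolding S using finB finite_symbol_indices by blast
  have "finite {length u | m u. (m, u) \<in> S}"
    by (rule finite_subset[of _ "(length \<circ> snd) ` S"]) (use finS in force)+
  \<comment> \<open>Finiteness makes d a genuine upper bound. If S is empty, \<open>Max {}\<close>
    leaves d unspecified, but then every sum over symbols is zero whatever d is.\<close>
  then have len: "length (snd \<sigma>) \<in> {0..d}" if "\<sigma> \<in> S" for \<sigma>
    using that unfolding assms(6) S_def[symmetric] by (cases \<sigma>) (auto intro!: Max_ge)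
  let ?le = "\<lambda>\<sigma> s. \<forall>i\<in>{1..n}. Poly_Mapping.lookup (md \<sigma>) i \<le> s i"
  define X where "X = (\<lambda>\<omega>. \<lambda>i\<in>{1..n}. c i \<omega>)"
  define w where "w s = measure P (X -` {s} \<inter> space P)" for s
  have pr: "pr P n c (md \<sigma>) = (\<Sum>s\<in>states n mx. w s * of_bool (?le \<sigma> s))" for \<sigma>
    using measure_random_state[OF rs, of "?le \<sigma>"] by (simp add: pr_def w_def X_def)
  \<comment> \<open>The identity of indicator functions at s, obtained by summing over u for each
    generator m and then counting the generators that survive.\<close>
  have point: "of_bool (l \<le> \<Phi> s) = (\<Sum>\<sigma>\<in>S. (-1) ^ length (snd \<sigma>) * (of_bool (?le \<sigma> s) :: real))"
    if s: "s \<in> states n mx" for s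
  proof -
    let ?C = "\<lambda>m. mdvd m (tuple_monomial n s) \<and> (\<forall>j\<in>{1..<max_var m}. Poly_Mapping.lookup m j = s j)"
    have "(\<Sum>\<sigma>\<in>S. (-1) ^ length (snd \<sigma>) * (of_bool (?le \<sigma> s) :: real)) =
        (\<Sum>m\<in>B. \<Sum>u\<in>symbol_indices m. (-1) ^ length u * of_bool (?le (m, u) s))"
      unfolding S using finB finite_symbol_indices
      by (subst sum.Sigma) (auto simp: case_prod_unfold)
    also have "\<dots> = (\<Sum>m\<in>B. of_bool (?C m))"
      using B by (intro sum.cong sum_symbol_indices) auto
    also have "\<dots> = real (card {m \<in> B. ?C m})"
      using finB by (simp add: sum_of_bool_eq Int_def conj_commute)
    also have "\<dots> = of_bool (l \<le> \<Phi> s)"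
      using stable_minimal_generator_ex1[OF assms(2-4) s] s
      unfolding B_def A_def by (simp add: paths_def)
    finally show ?thesis by simp
  qed
  have "reliability P n c \<Phi> l = (\<Sum>s\<in>states n mx. w s * of_bool (l \<le> \<Phi> s))"
    using measure_random_state[OF rs, of "\<lambda>s. l \<le> \<Phi> s"] by (simp add: reliability_def w_def X_def)
  also have "\<dots> = (\<Sum>s\<in>states n mx. \<Sum>\<sigma>\<in>S. (-1) ^ length (snd \<sigma>) * (w s * of_bool (?le \<sigma> s)))"
    by (rule sum.cong) (simp_all add: point sum_distrib_left mult.left_commute
        del: sum_mult_of_bool_eq sum_of_bool_mult_eq)
  also have "\<dots> = (\<Sum>\<sigma>\<in>S. (-1) ^ length (snd \<sigma>) * pr P n c (md \<sigma>))"
    unfolding pr sum_distrib_left by (rule sum.swap)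
  \<comment> \<open>The bound \<open>len\<close> ensures that the classes by length 0, ..., d
    exhaust S.\<close>
  also have "\<dots> = (\<Sum>i=0..d. \<Sum>\<sigma> | \<sigma> \<in> S \<and> length (snd \<sigma>) = i.
      (-1) ^ length (snd \<sigma>) * pr P n c (md \<sigma>))"
    by (rule sum.group[symmetric]) (use finS len in auto)
  also have "\<dots> = (\<Sum>i=0..d. (-1) ^ i * (\<Sum>\<sigma> | \<sigma> \<in> S \<and> length (snd \<sigma>) = i. pr P n c (md \<sigma>)))"
    unfolding sum_distrib_left by (intro sum.cong) auto
  finally show ?thesis unfolding S_def .
qed

end
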